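(* Let $G:\mathbb{R}^N\to\mathbb{R}$ be a smooth, strictly convex functional, let $\underline{q}^n\in\mathbb{R}^N$, and suppose that the forward Euler method is stable in $G$ for a range of positive step sizes: there is $\Delta t_{FE}>0$ such that $G(\underline{q}^n+\Delta t\,R(\underline{q}^n))\le G(\underline{q}^n)$ for all $0\le \Delta t\le \Delta t_{FE}$. Consider an explicit $s$-stage Runge-Kutta method whose coefficients satisfy $0\le a_{ij},c_i,b_j\le 1$ for all $i,j$. Then there exists $\Delta t^*>0$ such that for all $0<\Delta t\le\Delta t^*$ the stage solutions and the step solution satisfy $$G(\underline{q}^j)\le G(\underline{q}^n)\quad (j=1,\dots,s),\qquad G(\underline{q}^{RK})\le G(\underline{q}^n).$$
   Context: The ODE system is $\frac{d}{dt}\underline{q}=R(\underline{q})$ with $R:\mathbb{R}^N\to\mathbb{R}^N$. An explicit $s$-stage Runge-Kutta (RK) method has real coefficients $a_{ij}$ ($1\le i,j\le s$, $a_{ij}=0$ for $j\ge i$), $b_j$, and $c_i=\sum_{j=1}^s a_{ij}$, with $\sum_{j=1}^s b_j=1$. Starting from $\underline{q}^n$ with step size $\Delta t$, its stage solutions, stage derivatives and step solution are $$\underline{q}^i=\underline{q}^n+\Delta t\sum_{j=1}^s a_{ij}\underline{R}^j,\qquad \underline{R}^i=R(\underline{q}^i)\quad (i=1,\dots,s),\qquad \underline{q}^{RK}=\underline{q}^n+\Delta t\sum_{j=1}^s b_j\underline{R}^j .$$ Strictly convex for smooth $G$ is understood in the sense that $v^T\nabla^2G(\underline{q})\,v>0$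 for all $\underline{q}$ and all $v\ne \underline{0}$. Standing regularity convention on $R$: $\underline{R}^j=R(\underline{q}^n)+\mathcal{O}(\Delta t)$ as $\Delta t\to0^+$ for every stage $j$. *)

theory Defs
  imports "HOL-Analysis.Analysis" "HOL-Library.Landau_Symbols"
begin

text \<open>\<open>C_k k f\<close>: \<open>f\<close> is of class $C^k$ on the whole space. The derivatives are taken along
  all fixed directions; in finite dimension this is the usual notion.\<close>

primrec C_k :: "nat \<Rightarrow> (real ^ 'n \<Rightarrow> real) \<Rightarrow> bool" where
  "C_k 0 f \<longleftrightarrow> continuous_on UNIV f"
| "C_k (Suc k) f \<longleftrightarrow>
     (\<forall>x. f differentiable (at x)) \<and> (\<forall>v. C_k k (\<lambda>x. frechet_derivative f (at x) v))"

definition smooth :: "(real ^ 'n \<Rightarrow> real) \<Rightarrow> bool" where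
  "smooth f \<longleftrightarrow> (\<forall>k. C_k k f)"

definition gradient :: "(real ^ 'n \<Rightarrow> real) \<Rightarrow> real ^ 'n \<Rightarrow> real ^ 'n" where
  "gradient f x = (\<chi> i. frechet_derivative f (at x) (axis i 1))"

definition hessian :: "(real ^ 'n \<Rightarrow> real) \<Rightarrow> real ^ 'n \<Rightarrow> real ^ 'n ^ 'n" where
  "hessian f x = jacobian (gradient f) (at x)"

text \<open>Strict convexity in the sense of an everywhere positive definite Hessian, which is stronger
  than the order-theoretic notion. It is meant for smooth \<open>f\<close>: for others the Hessian may be
  unspecified.\<close>

definition strictly_convex :: "(real ^ 'n \<Rightarrow> real) \<Rightarrow> bool" where
  "strictly_convex f \<longleftrightarrow> (\<forall>x v. v \<noteq> 0 \<longrightarrow> v \<bullet> (hessian f x *v v) > 0)"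

text \<open>Stages are numbered \<open>1, \<dots>, s\<close>; coefficients outside this range are irrelevant.\<close>

definition explicit_rk ::
  "nat \<Rightarrow> (nat \<Rightarrow> nat \<Rightarrow> real) \<Rightarrow> (nat \<Rightarrow> real) \<Rightarrow> (nat \<Rightarrow> real) \<Rightarrow> bool" where
  "explicit_rk s a b c \<longleftrightarrow>
     (\<forall>i\<in>{1..s}. \<forall>j\<in>{1..s}. j \<ge> i \<longrightarrow> a i j = 0) \<and>
     (\<forall>i\<in>{1..s}. c i = (\<Sum>j=1..s. a i j)) \<and>
     (\<Sum>j=1..s. b j) = 1"

definition rk_stages ::
  "nat \<Rightarrow> (nat \<Rightarrow> nat \<Rightarrow> real) \<Rightarrow> (real ^ 'n \<Rightarrow> real ^ 'n) \<Rightarrow> real ^ 'n \<Rightarrow> real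
     \<Rightarrow> (nat \<Rightarrow> real ^ 'n) \<Rightarrow> bool" where
  "rk_stages s a R qn \<Delta>t q \<longleftrightarrow>
     (\<forall>i\<in>{1..s}. q i = qn + \<Delta>t *\<^sub>R (\<Sum>j=1..s. a i j *\<^sub>R R (q j)))"

definition rk_step ::
  "nat \<Rightarrow> (nat \<Rightarrow> real) \<Rightarrow> (real ^ 'n \<Rightarrow> real ^ 'n) \<Rightarrow> real ^ 'n \<Rightarrow> real
     \<Rightarrow> (nat \<Rightarrow> real ^ 'n) \<Rightarrow> real ^ 'n" where
  "rk_step s b R qn \<Delta>t q = qn + \<Delta>t *\<^sub>R (\<Sum>j=1..s. b j *\<^sub>R R (q j))"

text \<open>For an explicit method the stage equations determine the stage solutions.\<close>

fun rk_rec ::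
  "(nat \<Rightarrow> nat \<Rightarrow> real) \<Rightarrow> (real ^ 'n \<Rightarrow> real ^ 'n) \<Rightarrow> real ^ 'n \<Rightarrow> real \<Rightarrow> nat \<Rightarrow> real ^ 'n" where
  "rk_rec a R qn \<Delta>t i = qn + \<Delta>t *\<^sub>R (\<Sum>j\<in>{1..<i}. a i j *\<^sub>R R (rk_rec a R qn \<Delta>t j))"

declare rk_rec.simps [simp del]

lemma explicit_sum:
  fixes f :: "nat \<Rightarrow> real ^ 'n"
  assumes "explicit_rk s a b c" "i \<in> {1..s}"
  shows "(\<Sum>j=1..s. a i j *\<^sub>R f j) = (\<Sum>j\<in>{1..<i}. a i j *\<^sub>R f j)"
  by (rule sum.mono_neutral_right) (use assms in \<open>auto simp: explicit_rk_def\<close>)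

lemma rk_stages_iff:
  fixes R :: "real ^ 'n \<Rightarrow> real ^ 'n"
  assumes e: "explicit_rk s a b c"
  shows "rk_stages s a R qn \<Delta>t q \<longleftrightarrow> (\<forall>i\<in>{1..s}. q i = rk_rec a R qn \<Delta>t i)"
proof
  assume q: "rk_stages s a R qn \<Delta>t q"
  have "i \<in> {1..s} \<Longrightarrow> q i = rk_rec a R qn \<Delta>t i" for i
  proof (induction i rule: less_induct)
    case (less i)
    have "q i = qn + \<Delta>t *\<^sub>R (\<Sum>j\<in>{1..<i}. a i j *\<^sub>R R (q j))"
      using q less.prems explicit_sum [OF e less.prems, of "\<lambda>j. R (q j)"]
      by (simp add: rk_stages_def)
    also have "\<dots> = rk_rec a R qn \<Delta>t i"
      using less by (simp add: rk_rec.simps [of a R qn \<Delta>t i])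
    finally show ?case .
  qed
  then show "\<forall>i\<in>{1..s}. q i = rk_rec a R qn \<Delta>t i" by blast
next
  assume q: "\<forall>i\<in>{1..s}. q i = rk_rec a R qn \<Delta>t i"
  show "rk_stages s a R qn \<Delta>t q"
    unfolding rk_stages_def
  proof
    fix i assume i: "i \<in> {1..s}"
    then have "q i = qn + \<Delta>t *\<^sub>R (\<Sum>j\<in>{1..<i}. a i j *\<^sub>R R (q j))"
      using q by (simp add: rk_rec.simps [of a R qn \<Delta>t i])
    then show "q i = qn + \<Delta>t *\<^sub>R (\<Sum>j=1..s. a i j *\<^sub>R R (q j))"
      using explicit_sum [OF e i, of "\<lambda>j. R (q j)"] by simp
  qed
qed

end

theory Submission
  imports Defs
begin

text \<open>If \<open>R qn = 0\<close>, explicitness makes every stage equal to \<open>qn\<close>. Otherwise \<open>G\<close> is strictly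
  convex along the ray \<open>qn + t R qn\<close>, so the forward Euler bound forces its slope at \<open>t = 0\<close> to be
  negative. All stage derivatives tend to \<open>R qn\<close>, so the increment of a stage or of the step,
  divided by \<open>\<Delta>t\<close>, tends to a nonnegative multiple of \<open>R qn\<close>: a positive multiple gives a strict
  decrease of \<open>G\<close> for small \<open>\<Delta>t\<close>, and the multiple \<open>c i\<close> vanishes only if the whole row of
  nonnegative coefficients does, in which case the stage is \<open>qn\<close> itself.\<close>

lemma smooth_has_derivative:
  assumes "smooth f"
  shows "(f has_derivative frechet_derivative f (at x)) (at x)"
proof -
  have "C_k 1 f" using assms by (simp add: smooth_def)
  then show ?thesis by (simp add: frechet_derivative_works)
qed

text \<open>Linearity of the derivative over the standard basis. This lets the slope along a ray be
  differentiated once more via the gradient.\<close>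

lemma inner_gradient:
  assumes "smooth f"
  shows "v \<bullet> gradient f x = frechet_derivative f (at x) v"
proof -
  let ?D = "frechet_derivative f (at x)"
  have lin: "linear ?D"
    using smooth_has_derivative [OF assms] by (rule has_derivative_linear)
  have "?D v = ?D (\<Sum>i\<in>UNIV. v $ i *\<^sub>R axis i 1)"
    using basis_expansion [of v] by (simp add: scalar_mult_eq_scaleR)
  also have "\<dots> = (\<Sum>i\<in>UNIV. v $ i * ?D (axis i 1))"
    using lin by (simp add: linear_sum linear_cmul)
  also have "\<dots> = v \<bullet> gradient f x"
    by (simp add: inner_vec_def gradient_def)
  finally show ?thesis by simp
qed

text \<open>Each component of the gradient is a directional derivative, differentiable because
  \<open>f\<close> is of class \<open>C_k 2\<close>. So the Jacobian defining \<open>hessian\<close>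
  is a true derivative.\<close>

lemma has_derivative_gradient:
  assumes "smooth f"
  shows "(gradient f has_derivative (\<lambda>h. hessian f x *v h)) (at x)"
proof -
  have "C_k (Suc 1) f" using assms unfolding smooth_def by blast
  then have "(\<lambda>y. frechet_derivative f (at y) v) differentiable (at x)" for v by simp
  then have "gradient f differentiable (at x)"
    by (subst differentiable_componentwise_within)
      (auto simp: Basis_vec_def gradient_def inner_axis)
  then show ?thesis
    unfolding hessian_def by (rule jacobian_works [THEN iffD1])
qed

text \<open>Positive curvature makes the slope along the ray strictly increasing. A nonnegative
  initial slope would then make \<open>G\<close> strictly increase up to \<open>h\<close>, against
  the bound there.\<close>

lemma strictly_convex_slope_negative:
  assumes G: "smooth G" "strictly_convex G"
    and v: "v \<noteq> 0" and h: "h > 0" "G (x + h *\<^sub>R v) \<le> G x"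
  shows "frechet_derivative G (at x) v < 0"
proof (rule ccontr)
  let ?\<phi>' = "\<lambda>t. v \<bullet> gradient G (x + t *\<^sub>R v)"
  assume "\<not> frechet_derivative G (at x) v < 0"
  then have D0: "?\<phi>' 0 \<ge> 0" using G(1) by (simp add: inner_gradient)
  have ray: "((\<lambda>t. x + t *\<^sub>R v) has_derivative (\<lambda>d. d *\<^sub>R v)) (at t)" for t
    by (auto intro!: derivative_eq_intros)
  have d1: "((\<lambda>t. G (x + t *\<^sub>R v)) has_real_derivative ?\<phi>' t) (at t)" for t
  proof -
    note D = smooth_has_derivative [OF G(1), of "x + t *\<^sub>R v"]
    show ?thesis
      using has_derivative_compose [OF ray D] has_derivative_linear [OF D] G(1)
      by (simp add: has_field_derivative_def inner_gradient linear_cmul mult_commute_abs)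
  qed
  have d2: "(?\<phi>' has_real_derivative v \<bullet> (hessian G (x + t *\<^sub>R v) *v v)) (at t)" for t
  proof -
    have "(?\<phi>' has_derivative (\<lambda>d. v \<bullet> (hessian G (x + t *\<^sub>R v) *v (d *\<^sub>R v)))) (at t)"
      by (intro has_derivative_inner_right has_derivative_compose [OF ray]
          has_derivative_gradient [OF G(1)])
    then show ?thesis
      by (simp add: has_field_derivative_def matrix_vector_mult_scaleR mult_commute_abs)
  qed
  have "?\<phi>' t > 0" if "t > 0" for t
  proof -
    have "?\<phi>' 0 < ?\<phi>' t"
      using that by (rule DERIV_pos_imp_increasing)
        (use d2 G(2) v in \<open>auto simp: strictly_convex_def\<close>)
    with D0 show ?thesis by linarith
  qed
  \<comment> \<open>The slope may vanish at \<open>t = 0\<close>, so monotonicity comes from its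
    sign on the open interval and continuity on the closed one.\<close>
  moreover have "continuous_on {0..h} (\<lambda>t. G (x + t *\<^sub>R v))"
    by (rule DERIV_continuous_on) (rule has_field_derivative_at_within [OF d1])
  ultimately have "G (x + 0 *\<^sub>R v) < G (x + h *\<^sub>R v)"
    using h(1) d1 by (intro DERIV_pos_imp_increasing_open [of 0 h "\<lambda>t. G (x + t *\<^sub>R v)"]) blast+
  with h(2) show False by simp
qed

text \<open>The direction may vary with \<open>t\<close>, as Runge-Kutta increments do. The
  difference quotient of \<open>G\<close> in \<open>t\<close> is \<open>D (w t)\<close> plus an
  error that vanishes in the limit, so it tends to \<open>D w0\<close>.\<close>

lemma eventually_decrease:
  fixes G :: "'a::real_normed_vector \<Rightarrow> real"
  assumes D: "(G has_derivative D) (at x)" and neg: "D w0 < 0"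
    and w: "(w \<longlongrightarrow> w0) (at_right 0)"
  shows "\<forall>\<^sub>F t in at_right 0. G (x + t *\<^sub>R w t) \<le> G x"
proof -
  have bl: "bounded_linear D" using D by (rule has_derivative_bounded_linear)
  \<comment> \<open>\<open>e x = 0\<close> because \<open>0 / 0 = 0\<close>, so \<open>e\<close> is continuous at \<open>x\<close>.\<close>
  define e where "e = (\<lambda>y. (G y - G x - D (y - x)) / norm (y - x))"
  have e0: "(e \<longlongrightarrow> 0) (at x)"
    using D by (simp add: has_derivative_at2 e_def diff_diff_eq)
  then have cont: "isCont e x"
    by (simp add: isCont_def e_def)
  have "((\<lambda>t. x + t *\<^sub>R w t) \<longlongrightarrow> x + 0 *\<^sub>R w0) (at_right 0)"
    by (intro tendsto_intros w)
  then have "((\<lambda>t. e (x + t *\<^sub>R w t)) \<longlongrightarrow> e x) (at_right 0)"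
    using isCont_tendsto_compose [OF cont] by simp
  then have "((\<lambda>t. D (w t) + e (x + t *\<^sub>R w t) * norm (w t)) \<longlongrightarrow> D w0 + e x * norm w0)
      (at_right 0)"
    by (intro tendsto_intros w bounded_linear.tendsto [OF bl])
  then have "\<forall>\<^sub>F t in at_right 0. D (w t) + e (x + t *\<^sub>R w t) * norm (w t) < 0"
    by (rule order_tendstoD(2)) (simp add: e_def neg)
  moreover have "\<forall>\<^sub>F t in at_right (0::real). t > 0"
    by (rule eventually_at_right_less)
  ultimately show ?thesis
  proof eventually_elim
    case (elim t)
    have "G (x + t *\<^sub>R w t) - G x = t * (D (w t) + e (x + t *\<^sub>R w t) * norm (w t))"
      using elim(2) linear_cmul [OF bounded_linear.linear [OF bl], of t "w t"]
        linear_0 [OF bounded_linear.linear [OF bl]]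
      \<comment> \<open>Both sides vanish if \<open>w t = 0\<close>; otherwise the nonzero norm of
        \<open>t *\<^sub>R w t\<close> cancels.\<close>
      by (cases "w t = 0") (simp_all add: e_def field_simps)
    also have "\<dots> < 0" using elim by (simp add: mult_pos_neg)
    finally show ?case by simp
  qed
qed

lemma rk_rec_equilibrium:
  assumes "R qn = 0"
  shows "rk_rec a R qn \<Delta>t i = qn"
proof (induction i rule: less_induct)
  case (less i)
  then show ?case using assms by (simp add: rk_rec.simps [of _ _ _ _ i])
qed

lemma rk_step_equilibrium:
  assumes "R qn = 0" "explicit_rk s a b c" "rk_stages s a R qn \<Delta>t q"
  shows "rk_step s b R qn \<Delta>t q = qn"
  using assms by (simp add: rk_stages_iff rk_rec_equilibrium rk_step_def)

theorem theorem3: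
  fixes G :: "real ^ 'n \<Rightarrow> real"
    and R :: "real ^ 'n \<Rightarrow> real ^ 'n"
    and qn :: "real ^ 'n"
    and s :: nat
    and a :: "nat \<Rightarrow> nat \<Rightarrow> real"
    and b c :: "nat \<Rightarrow> real"
    and q :: "real \<Rightarrow> nat \<Rightarrow> real ^ 'n"
  assumes "smooth G"
    and "strictly_convex G"
    and "\<exists>\<Delta>t_FE>0. \<forall>\<Delta>t. 0 \<le> \<Delta>t \<and> \<Delta>t \<le> \<Delta>t_FE \<longrightarrow> G (qn + \<Delta>t *\<^sub>R R qn) \<le> G qn"
    and "explicit_rk s a b c"
    and "\<forall>i\<in>{1..s}. \<forall>j\<in>{1..s}. 0 \<le> a i j \<and> a i j \<le> 1"
    and "\<forall>i\<in>{1..s}. 0 \<le> c i \<and> c i \<le> 1"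
    and "\<forall>j\<in>{1..s}. 0 \<le> b j \<and> b j \<le> 1"
    and "\<forall>\<Delta>t>0. rk_stages s a R qn \<Delta>t (q \<Delta>t)"
    and "\<forall>j\<in>{1..s}. (\<lambda>\<Delta>t. norm (R (q \<Delta>t j) - R qn)) \<in> O[at_right 0](\<lambda>\<Delta>t. \<Delta>t)"
  shows "\<exists>\<Delta>t_star>0. \<forall>\<Delta>t. 0 < \<Delta>t \<and> \<Delta>t \<le> \<Delta>t_star \<longrightarrow>
           (\<forall>j\<in>{1..s}. G (q \<Delta>t j) \<le> G qn) \<and> G (rk_step s b R qn \<Delta>t (q \<Delta>t)) \<le> G qn"
proof -
  have "\<forall>\<^sub>F t in at_right 0. (\<forall>j\<in>{1..s}. G (q t j) \<le> G qn) \<and> G (rk_step s b R qn t (q t)) \<le> G qn"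
  proof (cases "R qn = 0")
    case True
    have "\<forall>\<^sub>F t in at_right (0::real). t > 0"
      by (rule eventually_at_right_less)
    then show ?thesis
    proof eventually_elim
      case (elim t)
      then have "rk_stages s a R qn t (q t)" using assms(8) by blast
      then show ?case
        using True assms(4)
        by (simp add: rk_stages_iff rk_rec_equilibrium rk_step_equilibrium)
    qed
  next
    case False
    let ?D = "frechet_derivative G (at qn)"
    have DG: "(G has_derivative ?D) (at qn)"
      using assms(1) by (rule smooth_has_derivative)
    obtain h where "h > 0" "G (qn + h *\<^sub>R R qn) \<le> G qn"
      using assms(3) less_imp_le by blast
    then have neg: "?D (R qn) < 0"
      by (rule strictly_convex_slope_negative [OF assms(1,2) False])
    have R_lim: "((\<lambda>t. R (q t j)) \<longlongrightarrow> R qn) (at_right 0)" if j: "j \<in> {1..s}" for j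
    proof -
      obtain K where K: "\<forall>\<^sub>F t in at_right 0. norm (norm (R (q t j) - R qn)) \<le> K * norm t"
        by (rule landau_o.bigE [OF assms(9) [rule_format, OF j]])
      have "((\<lambda>t. K * norm t) \<longlongrightarrow> K * norm (0::real)) (at_right (0::real))"
        by (intro tendsto_intros)
      then have "((\<lambda>t. R (q t j) - R qn) \<longlongrightarrow> 0) (at_right 0)"
        using K by (simp add: Lim_null_comparison [of _ "\<lambda>t. K * norm t"])
      then show ?thesis by (simp add: LIM_zero_iff)
    qed
    \<comment> \<open>The weights \<open>d\<close> stand for a row \<open>a i\<close> or for
      \<open>b\<close>, so stages and step are treated alike.\<close>
    have decrease: "\<forall>\<^sub>F t in at_right 0. G (qn + t *\<^sub>R (\<Sum>j=1..s. d j *\<^sub>R R (q t j))) \<le> G qn"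
      if "(\<Sum>j=1..s. d j) > 0" for d
    proof (rule eventually_decrease [OF DG])
      show "((\<lambda>t. \<Sum>j=1..s. d j *\<^sub>R R (q t j)) \<longlongrightarrow> (\<Sum>j=1..s. d j *\<^sub>R R qn)) (at_right 0)"
        by (intro tendsto_intros R_lim)
      \<comment> \<open>The limit direction is the sum of the weights times \<open>R qn\<close>, so
        this is a positive multiple of the negative slope.\<close>
      show "?D (\<Sum>j=1..s. d j *\<^sub>R R qn) < 0"
        using neg that linear_cmul [OF has_derivative_linear [OF DG]]
        by (simp add: mult_pos_neg flip: scaleR_left.sum)
    qed
    have pos: "\<forall>\<^sub>F t in at_right (0::real). t > 0"
      by (rule eventually_at_right_less)
    have "\<forall>\<^sub>F t in at_right 0. G (q t i) \<le> G qn" if i: "i \<in> {1..s}" for i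
    proof -
      have q: "q t i = qn + t *\<^sub>R (\<Sum>j=1..s. a i j *\<^sub>R R (q t j))" if "t > 0" for t
        using assms(8) that i by (simp add: rk_stages_def)
      have nonneg: "\<forall>j\<in>{1..s}. 0 \<le> a i j" using assms(5) i by blast
      show ?thesis
      proof (cases "(\<Sum>j=1..s. a i j) > 0")
        case True
        from decrease [OF True] pos show ?thesis
          by eventually_elim (use q in auto)
      next
        case False
        then have "(\<Sum>j=1..s. a i j) = 0"
          using sum_nonneg [of "{1..s}" "a i"] nonneg by fastforce
        then have "\<forall>j\<in>{1..s}. a i j = 0"
          using nonneg by (subst (asm) sum_nonneg_eq_0_iff) auto
        with pos show ?thesis
          by (auto elim!: eventually_mono simp: q)
      qed
    qed
    \<comment> \<open>Consistency gives weight sum 1, so no degenerate case arises here.\<close>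
    moreover have "\<forall>\<^sub>F t in at_right 0. G (rk_step s b R qn t (q t)) \<le> G qn"
      using decrease [of b] assms(4) by (simp add: rk_step_def explicit_rk_def)
    ultimately show ?thesis
      by (intro eventually_conj eventually_ball_finite) auto
  qed
  then obtain r where "r > 0" and
    r: "\<forall>t>0. t < r \<longrightarrow> (\<forall>j\<in>{1..s}. G (q t j) \<le> G qn) \<and> G (rk_step s b R qn t (q t)) \<le> G qn"
    unfolding eventually_at_right_field by auto
  \<comment> \<open>Halving turns the strict bound \<open>t < r\<close> into a closed range of step
    sizes.\<close>
  then show ?thesis by (intro exI [of _ "r / 2"]) auto
qed

end
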